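(* Let $n$ be a positive integer. The unitary Cayley graph $X_n$ admits fractional revival if and only if $n=2$ or $n=2p$ for some prime $p$.
   Context: The unitary Cayley graph $X_n$ is the simple undirected graph with vertex set $\mathbb{Z}_n$ in which two distinct vertices $a,b$ are adjacent if and only if $a-b\equiv u \pmod n$ for some integer $u$ with $1\le u\le n-1$ and $\gcd(u,n)=1$. For a finite simple undirected graph $\Gamma$ with adjacency matrix $A$, the transition matrix is $H(t)=\exp(-\mathbf{i}tA)$, $t\in\mathbb{R}$, where $\mathbf{i}=\sqrt{-1}$. For a vertex $a$, $\mathbf{e}_a$ is the standard basis column vector indexed by the vertices with entry $1$ at $a$ and $0$ elsewhere. $\Gamma$ admits fractional revival (FR) from a vertex $a$ to another vertex $b\ne a$ if there is a real number $t>0$ such that $H(t)\mathbf{e}_a=\alpha\mathbf{e}_a+\beta\mathbf{e}_b$ for some complex numbers $\alpha,\beta$ with $\beta\neq 0$ and $|\alpha|^2+|\beta|^2=1$. $\Gamma$ admits FR if it does so from some vertex $a$ to some other vertex $b$. *)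

theory Defs
  imports
    Complex_Main
    "HOL-Computational_Algebra.Primes"
    "HOL-Number_Theory.Cong"
    "Graph_Theory.Pair_Digraph"
    "Jordan_Normal_Form.Jordan_Normal_Form"
begin

(* A finite simple undirected graph is a Graph_Theory pair_graph: a finite loop-free digraph
   with a symmetric arc set.  Z_n is represented by the residues 0, ..., n - 1. *)

definition unitary_cayley_graph :: "nat \<Rightarrow> nat pair_pre_digraph" where
  "unitary_cayley_graph n =
     \<lparr> pverts = {..<n},
       parcs = {(a, b). a < n \<and> b < n \<and> a \<noteq> b \<and>
                  (\<exists>u::int. 1 \<le> u \<and> u \<le> int n - 1 \<and> gcd u (int n) = 1 \<and>
                     [int a - int b = u] (mod int n))} \<rparr>"

lemma pair_graph_unitary_cayley_graph: "pair_graph (unitary_cayley_graph n)"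
proof -
  let ?G = "unitary_cayley_graph n"
  have fin: "finite (parcs ?G)"
    by (rule finite_subset[of _ "{..<n} \<times> {..<n}"]) (auto simp: unitary_cayley_graph_def)
  have "(b, a) \<in> parcs ?G" if "(a, b) \<in> parcs ?G" for a b
  proof -
    from that obtain u :: int where u: "1 \<le> u" "u \<le> int n - 1" "gcd u (int n) = 1"
        "[int a - int b = u] (mod int n)" and ab: "a < n" "b < n" "a \<noteq> b"
      by (auto simp: unitary_cayley_graph_def)
    have "gcd (int n - u) (int n) = 1"
      using u(3) by (metis gcd.commute gcd_diff2)
    moreover have "[int b - int a = int n - u] (mod int n)"
    proof -
      have "int n dvd (int a - int b) - u" using u(4) by (simp add: cong_iff_dvd_diff)
      then have "int n dvd - ((int a - int b) - u) - int n" by (metis dvd_diff dvd_minus_iff dvd_refl)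
      moreover have "- ((int a - int b) - u) - int n = (int b - int a) - (int n - u)" by simp
      ultimately show ?thesis by (simp only: cong_iff_dvd_diff)
    qed
    ultimately show ?thesis using u ab
      by (auto simp: unitary_cayley_graph_def intro!: exI[of _ "int n - u"])
  qed
  then have sym: "sym (parcs ?G)" by (auto intro: symI)
  show ?thesis
    using fin sym by unfold_locales (auto simp: unitary_cayley_graph_def symmetric_def)
qed

(* Rows and columns are indexed by the vertices themselves, so this is the adjacency matrix
   of G provided that G has vertex set {..<n} for some n. *)
definition adjacency_matrix :: "nat pair_pre_digraph \<Rightarrow> complex mat" where
  "adjacency_matrix G =
     mat (card (pverts G)) (card (pverts G)) (\<lambda>(a, b). if (a, b) \<in> parcs G then 1 else 0)"

(* The entrywise limit of the exponential series; suminf is genuine by summable_mat_exp below. *)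
definition mat_exp :: "complex mat \<Rightarrow> complex mat" where
  "mat_exp A =
     mat (dim_row A) (dim_col A) (\<lambda>(i, j). \<Sum>k. (A ^\<^sub>m k) $$ (i, j) / fact k)"

lemma summable_mat_exp:
  fixes A :: "complex mat"
  assumes A: "A \<in> carrier_mat n n" and ij: "i < n" "j < n"
  shows "summable (\<lambda>k. (A ^\<^sub>m k) $$ (i, j) / fact k)"
proof -
  obtain b where b: "norm_bound A b" using norm_bound_max by blast
  have bound: "norm_bound (A ^\<^sub>m k) ((b * real n) ^ k)" for k
  proof (induction k)
    case 0
    show ?case using A by (auto simp: norm_bound_def)
  next
    case (Suc k)
    from norm_bound_mult[OF pow_carrier_mat[OF A] A Suc.IH b]
    show ?case by (simp add: mult_ac)
  qed
  show ?thesis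
  proof (rule summable_comparison_test'[where N = 0])
    show "summable (\<lambda>k. (b * real n) ^ k / fact k)"
      using summable_exp[of "b * real n"] by (simp add: field_simps)
    show "norm ((A ^\<^sub>m k) $$ (i, j) / fact k) \<le> (b * real n) ^ k / fact k" for k
      using bound[of k] A ij
      by (auto simp: norm_bound_def norm_divide pow_mat_dim intro!: divide_right_mono)
  qed
qed

definition transition_matrix :: "nat pair_pre_digraph \<Rightarrow> real \<Rightarrow> complex mat" where
  "transition_matrix G t = mat_exp ((- \<i> * of_real t) \<cdot>\<^sub>m adjacency_matrix G)"

abbreviation vertex_vec :: "nat pair_pre_digraph \<Rightarrow> nat \<Rightarrow> complex vec" where
  "vertex_vec G a \<equiv> unit_vec (card (pverts G)) a"

definition fractional_revival_from_to :: "nat pair_pre_digraph \<Rightarrow> nat \<Rightarrow> nat \<Rightarrow> bool" where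
  "fractional_revival_from_to G a b \<longleftrightarrow>
     (\<exists>t>0. \<exists>\<alpha> \<beta>. transition_matrix G t *\<^sub>v vertex_vec G a =
                     \<alpha> \<cdot>\<^sub>v vertex_vec G a + \<beta> \<cdot>\<^sub>v vertex_vec G b \<and>
                   \<beta> \<noteq> 0 \<and> (cmod \<alpha>)\<^sup>2 + (cmod \<beta>)\<^sup>2 = 1)"

definition admits_fractional_revival :: "nat pair_pre_digraph \<Rightarrow> bool" where
  "admits_fractional_revival G \<longleftrightarrow>
     (\<exists>a\<in>pverts G. \<exists>b\<in>pverts G. b \<noteq> a \<and> fractional_revival_from_to G a b)"

end

(* The adjacency matrix of X_n is circulant, with eigenvalues the Ramanujan sums c_n(k).
   Since c_n(-k) = c_n(k), fractional revival from a to b forces b - a = n/2 and says exactly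
   that exp(-i t c_n(k)) takes two distinct values, one on even and one on odd k.
   For a prime p, splitting off the multiples of p among the residues coprime to m gives
     c_{pm}(k) = [p | k] p c_m(k/p) - [p does not divide m] c_m(k),
   hence c_n(1) = 0 if n is not squarefree, and c_n(p) = -(p - 1) c_n(1) if n is squarefree and
   p | n. If an even squarefree n is divisible by two odd primes p and q, then
   w = exp(-i t c_n(1)) satisfies w^p = w^q = 1, so that w = 1 and the two values coincide.
   If 4 | n, then c_n(2k) = 2 c_{n/2}(k) allows the same argument for n/2, with 2 and an odd prime. *)
theory Submission
  imports Defs "HOL-Computational_Algebra.Squarefree"
begin

section \<open>Roots of unity, periodic sums and Ramanujan sums\<close>

definition unity_root :: "nat \<Rightarrow> int \<Rightarrow> complex" where
  "unity_root n k = cis (2 * pi * of_int k / of_nat n)"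

lemma unity_root_0 [simp]: "unity_root n 0 = 1"
  by (simp add: unity_root_def)

lemma unity_root_add: "unity_root n (a + b) = unity_root n a * unity_root n b"
  by (simp add: unity_root_def cis_mult add_divide_distrib distrib_left)

lemma unity_root_minus_mult [simp]: "unity_root n (- a) * unity_root n a = 1"
  by (simp flip: unity_root_add)

lemma unity_root_power: "unity_root n a ^ k = unity_root n (a * int k)"
  by (simp add: unity_root_def Complex.DeMoivre mult_ac)

lemma unity_root_eq_1_iff:
  assumes "n > 0"
  shows "unity_root n k = 1 \<longleftrightarrow> int n dvd k"
proof -
  have "unity_root n k = 1 \<longleftrightarrow> (\<exists>x::int. 2 * pi * of_int k / of_nat n = of_int (2 * x) * pi)"
  proof -
    have "cis x = 1 \<longleftrightarrow> cos x = 1" for x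
      by (auto simp: complex_eq_iff dest: cos_one_sin_zero)
    then show ?thesis
      unfolding unity_root_def by (simp add: cos_one_2pi_int mult_ac)
  qed
  also have "\<dots> \<longleftrightarrow> (\<exists>x::int. k = int n * x)"
  proof -
    have "2 * pi * of_int k / of_nat n = of_int (2 * x) * pi \<longleftrightarrow> k = int n * x" for x :: int
    proof -
      have "2 * pi * of_int k / of_nat n = of_int (2 * x) * pi \<longleftrightarrow> real_of_int k = real n * of_int x"
        using assms by (auto simp: field_simps)
      also have "real n * of_int x = real_of_int (int n * x)"
        by simp
      finally show ?thesis
        by (simp only: of_int_eq_iff)
    qed
    then show ?thesis by simp
  qed
  finally show ?thesis by (simp add: dvd_def)
qed

lemma unity_root_eq_iff:
  assumes "n > 0"
  shows "unity_root n a = unity_root n b \<longleftrightarrow> [a = b] (mod int n)"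
proof -
  have "unity_root n a = unity_root n (a - b) * unity_root n b"
    by (simp flip: unity_root_add)
  moreover have "unity_root n b \<noteq> 0"
    by (simp add: unity_root_def)
  ultimately have "unity_root n a = unity_root n b \<longleftrightarrow> unity_root n (a - b) = 1"
    by simp
  then show ?thesis
    using assms by (simp add: unity_root_eq_1_iff cong_iff_dvd_diff)
qed

lemma unity_root_cancel:
  "p > 0 \<Longrightarrow> unity_root (p * m) (int p * k) = unity_root m k"
  by (simp add: unity_root_def mult.assoc)

text \<open>Orthogonality of the additive characters modulo \<open>n\<close>: when \<open>n\<close>
  does not divide \<open>k\<close>, the sum is geometric with ratio \<open>unity_root n k\<close>,
  which is not 1 but has \<open>n\<close>-th power 1.\<close>

lemma sum_unity_root:
  assumes "n > 0"
  shows "(\<Sum>j<n. unity_root n (k * int j)) = (if int n dvd k then of_nat n else 0)"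
proof (cases "int n dvd k")
  case True
  then have "unity_root n (k * int j) = 1" for j
    using assms by (simp add: unity_root_eq_1_iff)
  with True show ?thesis by simp
next
  case False
  then have "unity_root n k \<noteq> 1"
    using assms by (simp add: unity_root_eq_1_iff)
  moreover have "unity_root n k ^ n = 1"
    using assms by (simp add: unity_root_power unity_root_eq_1_iff)
  ultimately have "(\<Sum>j<n. unity_root n k ^ j) = 0"
    by (simp add: geometric_sum)
  with False show ?thesis by (simp add: unity_root_power)
qed

text \<open>Moving the window by one trades \<open>f s\<close> for the equal value
  \<open>f (s + int n)\<close>; induction on the integer \<open>s\<close> runs in both directions,
  so negative shifts are covered.\<close>

lemma sum_periodic_shift:
  fixes f :: "int \<Rightarrow> 'a :: ab_group_add"
  assumes "\<And>x. f (x + int n) = f x"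
  shows "(\<Sum>u<n. f (int u + s)) = (\<Sum>u<n. f (int u))"
proof -
  have step: "(\<Sum>u<n. f (int u + (s + 1))) = (\<Sum>u<n. f (int u + s))" for s
  proof -
    have "(\<Sum>u<Suc n. f (int u + s)) = f s + (\<Sum>u<n. f (int u + (s + 1)))"
      by (subst sum.lessThan_Suc_shift) (simp add: algebra_simps)
    moreover have "(\<Sum>u<Suc n. f (int u + s)) = (\<Sum>u<n. f (int u + s)) + f s"
      using assms[of s] by (simp add: add.commute)
    ultimately show ?thesis by (simp add: algebra_simps)
  qed
  show ?thesis
  proof (induction s rule: int_induct[where k = 0])
    case base
    show ?case by simp
  next
    case (step1 i)
    then show ?case using step[of i] by simp
  next
    case (step2 i)
    then show ?case using step[of "i - 1"] by simp
  qed
qed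

text \<open>By periodicity, \<open>- int u\<close> may be replaced by
  \<open>int (n - Suc u) + 1\<close>. Reversing the range leaves only a shift by 1, which does not
  change the sum.\<close>

lemma sum_periodic_uminus:
  fixes f :: "int \<Rightarrow> 'a :: ab_group_add"
  assumes "\<And>x. f (x + int n) = f x"
  shows "(\<Sum>u<n. f (- int u)) = (\<Sum>u<n. f (int u))"
proof -
  have "(\<Sum>u<n. f (- int u)) = (\<Sum>u<n. f (int (n - Suc u) + 1))"
  proof (rule sum.cong)
    fix u assume "u \<in> {..<n}"
    then have "int (n - Suc u) + 1 = - int u + int n" by auto
    then show "f (- int u) = f (int (n - Suc u) + 1)" using assms[of "- int u"] by simp
  qed simp
  also have "\<dots> = (\<Sum>u<n. f (int u + 1))"
    by (rule sum.nat_diff_reindex[where g = "\<lambda>u. f (int u + 1)"])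
  also have "\<dots> = (\<Sum>u<n. f (int u))"
    by (rule sum_periodic_shift) (rule assms)
  finally show ?thesis .
qed

text \<open>The sum runs over 0, ..., \<open>n - 1\<close> rather than 1, ..., \<open>n\<close>. For
  \<open>n = 1\<close> the index 0 counts as coprime, so c_1(k) = 1 as it should be.\<close>

definition ramanujan_sum :: "nat \<Rightarrow> int \<Rightarrow> complex" where
  "ramanujan_sum n k =
     (\<Sum>u<n. of_bool (coprime (int u) (int n)) * unity_root n (k * int u))"

lemma coprime_add_mult_iff: "coprime (a + k * m) m \<longleftrightarrow> coprime a (m::int)"
  using gcd_add_mult[of m k a] by (simp add: coprime_iff_gcd_eq_1 gcd.commute add.commute)

lemma ramanujan_sum_cong:
  assumes "n > 0" "[k = l] (mod int n)"
  shows "ramanujan_sum n k = ramanujan_sum n l"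
proof -
  have "unity_root n (k * x) = unity_root n (l * x)" for x
    using assms by (simp add: unity_root_eq_iff cong_scalar_right)
  then show ?thesis by (simp add: ramanujan_sum_def)
qed

lemma ramanujan_summand_period:
  assumes "n > 0"
  shows "of_bool (coprime (u + int n) (int n)) * unity_root n (k * (u + int n)) =
         (of_bool (coprime u (int n)) * unity_root n (k * u) :: complex)"
  using assms unity_root_eq_1_iff[of n "k * int n"] coprime_add_mult_iff[of u 1 "int n"]
  by (simp add: distrib_left unity_root_add)

lemma ramanujan_sum_uminus [simp]:
  assumes "n > 0"
  shows "ramanujan_sum n (- k) = ramanujan_sum n k"
  using sum_periodic_uminus[of "\<lambda>u. of_bool (coprime u (int n)) * unity_root n (k * u)" n]
  by (simp add: ramanujan_sum_def ramanujan_summand_period[OF assms])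

text \<open>Conjugation replaces \<open>k\<close> by \<open>- k\<close>, and c_n is even in
  \<open>k\<close>. The eigenvalues are therefore real and the exponentials below have modulus
  1.\<close>

lemma cnj_ramanujan_sum:
  assumes "n > 0"
  shows "cnj (ramanujan_sum n k) = ramanujan_sum n k"
proof -
  have "cnj (ramanujan_sum n k) = ramanujan_sum n (- k)"
    by (simp add: ramanujan_sum_def unity_root_def cis_cnj)
  then show ?thesis using assms by simp
qed

subsection \<open>Spectral decomposition of the transition matrix\<close>

lemma card_pverts_unitary_cayley_graph [simp]: "card (pverts (unitary_cayley_graph n)) = n"
  by (simp add: unitary_cayley_graph_def)

text \<open>For \<open>n \<ge> 2\<close> coprimality rules out \<open>a = b\<close>, since gcd(0, n)
  = n. For \<open>n = 1\<close> the missing loop at 0 would satisfy the right-hand side.\<close>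

lemma unitary_cayley_graph_arc_iff:
  assumes "n \<ge> 2" "a < n" "b < n"
  shows "(a, b) \<in> parcs (unitary_cayley_graph n) \<longleftrightarrow> coprime (int a - int b) (int n)"
proof
  assume "(a, b) \<in> parcs (unitary_cayley_graph n)"
  then obtain u where "coprime u (int n)" "[int a - int b = u] (mod int n)"
    by (auto simp: unitary_cayley_graph_def)
  then show "coprime (int a - int b) (int n)"
    by (metis cong_gcd_eq coprime_iff_gcd_eq_1)
next
  assume *: "coprime (int a - int b) (int n)"
  define u where "u = (int a - int b) mod int n"
  have cop: "coprime u (int n)"
    using * assms by (simp add: u_def coprime_iff_gcd_eq_1)
  have "u \<noteq> 0"
    using cop assms by auto
  moreover have "0 \<le> u" "u < int n"
    using assms by (simp_all add: u_def)
  moreover have "a \<noteq> b"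
    using * assms by auto
  moreover have "[int a - int b = u] (mod int n)"
    by (simp add: u_def cong_def)
  ultimately show "(a, b) \<in> parcs (unitary_cayley_graph n)"
    using assms cop unfolding unitary_cayley_graph_def coprime_iff_gcd_eq_1
    by (auto intro!: exI[of _ u])
qed

text \<open>Characters are eigenvectors of the circulant adjacency matrix, with eigenvalue c_n(l):
  substitute y = x - j, sum over a full period and use c_n(-l) = c_n(l).\<close>

lemma sum_neighbours_unity_root:
  assumes "n > 0"
  shows "(\<Sum>x<n. unity_root n (l * (i - int x)) * of_bool (coprime (int x - j) (int n))) =
         unity_root n (l * (i - j)) * ramanujan_sum n l"
proof -
  let ?f = "\<lambda>y. of_bool (coprime y (int n)) * unity_root n (- l * y) :: complex"
  have "(\<Sum>x<n. unity_root n (l * (i - int x)) * of_bool (coprime (int x - j) (int n))) =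
        (\<Sum>x<n. unity_root n (l * (i - j)) * ?f (int x + - j))"
    by (intro sum.cong refl) (simp add: algebra_simps flip: unity_root_add)
  also have "\<dots> = unity_root n (l * (i - j)) * (\<Sum>x<n. ?f (int x))"
    unfolding sum_distrib_left[symmetric]
    by (subst sum_periodic_shift[of ?f]) (simp_all only: ramanujan_summand_period[OF assms])
  also have "(\<Sum>x<n. ?f (int x)) = ramanujan_sum n l"
    using ramanujan_sum_uminus[OF assms, of l] by (simp only: ramanujan_sum_def)
  finally show ?thesis .
qed

text \<open>Each further factor multiplies the \<open>l\<close>-th character by its eigenvalue. The
  base case, the identity matrix, is orthogonality of characters.\<close>

lemma power_adjacency_matrix_entry:
  assumes n: "n \<ge> 2" and ij: "i < n" "j < n"
  shows "((s \<cdot>\<^sub>m adjacency_matrix (unitary_cayley_graph n)) ^\<^sub>m m) $$ (i, j) =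
         (\<Sum>l<n. (s * ramanujan_sum n (int l)) ^ m * unity_root n (int l * (int i - int j))) / of_nat n"
  using ij
proof (induction m arbitrary: i j)
  case 0
  have "int n dvd int i - int j \<longleftrightarrow> i = j"
    using 0 by (simp flip: mod_eq_dvd_iff)
  then show ?case
    using 0 n sum_unity_root[of n "int i - int j"]
    by (simp add: mult.commute adjacency_matrix_def)
next
  case (Suc m)
  let ?B = "s \<cdot>\<^sub>m adjacency_matrix (unitary_cayley_graph n)"
  have B: "?B \<in> carrier_mat n n"
    by (simp add: adjacency_matrix_def)
  have Bx: "?B $$ (x, j) = s * of_bool (coprime (int x - int j) (int n))" if "x < n" for x
    using that Suc.prems n by (simp add: adjacency_matrix_def unitary_cayley_graph_arc_iff)
  have "(?B ^\<^sub>m Suc m) $$ (i, j) = (\<Sum>x<n. (?B ^\<^sub>m m) $$ (i, x) * ?B $$ (x, j))"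
    using Suc.prems B pow_carrier_mat[OF B, of m]
    by (simp add: scalar_prod_def atLeast0LessThan del: index_smult_mat)
  also have "\<dots> = (\<Sum>x<n. (\<Sum>l<n. (s * ramanujan_sum n (int l)) ^ m *
        unity_root n (int l * (int i - int x))) / of_nat n *
        (s * of_bool (coprime (int x - int j) (int n))))"
    using Suc.prems by (intro sum.cong refl) (simp add: Suc.IH Bx del: index_smult_mat)
  also have "\<dots> = (\<Sum>x<n. \<Sum>l<n. (s * ramanujan_sum n (int l)) ^ m * s / of_nat n *
        (unity_root n (int l * (int i - int x)) * of_bool (coprime (int x - int j) (int n))))"
    by (simp add: sum_distrib_left sum_divide_distrib mult_ac)
  also have "\<dots> = (\<Sum>l<n. (s * ramanujan_sum n (int l)) ^ m * s / of_nat n *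
        (\<Sum>x<n. unity_root n (int l * (int i - int x)) * of_bool (coprime (int x - int j) (int n))))"
    unfolding sum_distrib_left by (rule sum.swap)
  also have "\<dots> = (\<Sum>l<n. (s * ramanujan_sum n (int l)) ^ Suc m *
        unity_root n (int l * (int i - int j))) / of_nat n"
    using n by (subst sum_neighbours_unity_root) (simp_all add: sum_divide_distrib mult_ac)
  finally show ?case .
qed

text \<open>The exponential series is summed inside the finite sum over \<open>l\<close>, eigenvalue
  by eigenvalue.\<close>

lemma transition_matrix_entry:
  assumes n: "n \<ge> 2" and ij: "i < n" "j < n"
  shows "transition_matrix (unitary_cayley_graph n) t $$ (i, j) =
         (\<Sum>l<n. exp (- \<i> * of_real t * ramanujan_sum n (int l)) *
           unity_root n (int l * (int i - int j))) / of_nat n"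
proof -
  define s where "s = - \<i> * of_real t"
  have "(\<lambda>m. (s * ramanujan_sum n (int l)) ^ m / fact m) sums exp (s * ramanujan_sum n (int l))" for l
    using exp_converges[of "s * ramanujan_sum n (int l)"]
    by (simp add: scaleR_conv_of_real field_simps)
  then have "(\<lambda>m. (\<Sum>l<n. (s * ramanujan_sum n (int l)) ^ m / fact m *
          unity_root n (int l * (int i - int j))) / of_nat n) sums
        ((\<Sum>l<n. exp (s * ramanujan_sum n (int l)) * unity_root n (int l * (int i - int j))) / of_nat n)"
    by (intro sums_divide sums_sum sums_mult2)
  then have "(\<lambda>m. ((s \<cdot>\<^sub>m adjacency_matrix (unitary_cayley_graph n)) ^\<^sub>m m) $$ (i, j) / fact m) sums
        ((\<Sum>l<n. exp (s * ramanujan_sum n (int l)) * unity_root n (int l * (int i - int j))) / of_nat n)"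
    unfolding power_adjacency_matrix_entry[OF assms]
    by (simp add: sum_divide_distrib field_simps)
  then show ?thesis
    using ij unfolding transition_matrix_def mat_exp_def s_def
    by (simp add: adjacency_matrix_def sums_iff)
qed

lemma cmod_exp_ramanujan_sum:
  assumes "n > 0"
  shows "cmod (exp (- \<i> * of_real t * ramanujan_sum n k)) = 1"
proof -
  have "Im (ramanujan_sum n k) = 0"
    using cnj_ramanujan_sum[OF assms, of k] by (simp add: complex_eq_iff)
  then show ?thesis by simp
qed

text \<open>Fourier inversion of the entry formula: transforming column \<open>a\<close> isolates
  the exponential of a single eigenvalue.\<close>

lemma sum_unity_root_transition_matrix:
  assumes n: "n \<ge> 2" and ka: "k < n" "a < n"
  shows "(\<Sum>j<n. unity_root n (- int k * int j) *
            transition_matrix (unitary_cayley_graph n) t $$ (j, a)) =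
         exp (- \<i> * of_real t * ramanujan_sum n (int k)) * unity_root n (- int k * int a)"
proof -
  define E where "E l = exp (- \<i> * of_real t * ramanujan_sum n (int l))" for l :: nat
  have dvd_iff: "int n dvd int l - int k \<longleftrightarrow> l = k" if "l < n" for l
    using that ka by (simp flip: mod_eq_dvd_iff)
  have entry: "transition_matrix (unitary_cayley_graph n) t $$ (j, a) =
      (\<Sum>l<n. E l * unity_root n (int l * (int j - int a))) / of_nat n" if "j < n" for j
    unfolding E_def using transition_matrix_entry[OF n that ka(2)] .
  have char: "unity_root n (- int k * int j) * unity_root n (int l * (int j - int a)) =
      unity_root n (- int l * int a) * unity_root n ((int l - int k) * int j)" for j l
    by (simp add: algebra_simps flip: unity_root_add)
  have "(\<Sum>j<n. unity_root n (- int k * int j) *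
            transition_matrix (unitary_cayley_graph n) t $$ (j, a)) =
        (\<Sum>j<n. \<Sum>l<n. E l * unity_root n (- int l * int a) / of_nat n *
            unity_root n ((int l - int k) * int j))"
    using n ka
    by (intro sum.cong refl)
       (simp only: entry lessThan_iff sum_divide_distrib
         sum_distrib_left times_divide_eq_right times_divide_eq_left mult.assoc
         mult.left_commute[of _ "E _"] char)
  also have "\<dots> = (\<Sum>l<n. E l * unity_root n (- int l * int a) / of_nat n *
            (\<Sum>j<n. unity_root n ((int l - int k) * int j)))"
    unfolding sum_distrib_left by (rule sum.swap)
  also have "\<dots> = (\<Sum>l<n. if l = k then E l * unity_root n (- int l * int a) else 0)"
    using n by (intro sum.cong refl) (simp add: sum_unity_root dvd_iff)
  also have "\<dots> = E k * unity_root n (- int k * int a)"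
    using ka by simp
  finally show ?thesis by (simp only: E_def)
qed

section \<open>Fractional revival as a two-valued condition on the exponentials\<close>

lemma transition_matrix_mult_vertex_vec:
  assumes "a < n" "j < n"
  shows "(transition_matrix (unitary_cayley_graph n) t *\<^sub>v
            vertex_vec (unitary_cayley_graph n) a) $ j =
         transition_matrix (unitary_cayley_graph n) t $$ (j, a)"
  using assms by (simp add: transition_matrix_def mat_exp_def adjacency_matrix_def scalar_prod_right_unit)

text \<open>The hypotheses say that \<open>d\<close> is n/2 modulo \<open>n\<close>: its root of
  unity squares to 1 without being 1, so it is -1.\<close>

lemma unity_root_half:
  assumes "n > 0" "int n dvd 2 * d" "\<not> int n dvd d"
  shows "unity_root n (k * d) = (if even k then 1 else - 1)"
proof -
  have "unity_root n d * unity_root n d = 1"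
    using assms by (simp add: unity_root_eq_1_iff flip: unity_root_add mult_2)
  moreover have "unity_root n d \<noteq> 1"
    using assms by (simp add: unity_root_eq_1_iff)
  ultimately have m1: "unity_root n d = - 1"
    by (metis power2_eq_1_iff power2_eq_square)
  have even: "unity_root n (2 * j * d) = 1" for j
    using assms by (simp add: unity_root_eq_1_iff mult.assoc mult.left_commute[of _ j])
  show ?thesis
  proof (cases "even k")
    case True
    then show ?thesis using even by (auto elim!: evenE)
  next
    case False
    then obtain j where "k = 2 * j + 1" by (elim oddE)
    with False even[of j] m1 show ?thesis by (simp add: distrib_right unity_root_add)
  qed
qed

lemma unitary_cayley_graph_fractional_revivalD:
  assumes n: "n \<ge> 2" and FR: "admits_fractional_revival (unitary_cayley_graph n)"
  shows "even n \<and> (\<exists>t>0. \<exists>x y. x \<noteq> y \<and>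
           (\<forall>k. exp (- \<i> * of_real t * ramanujan_sum n k) = (if even k then x else y)))"
proof -
  let ?G = "unitary_cayley_graph n"
  obtain a b t \<alpha> \<beta> where ab: "a < n" "b < n" "a \<noteq> b" and t: "t > 0" and \<beta>: "\<beta> \<noteq> 0"
    and H: "transition_matrix ?G t *\<^sub>v vertex_vec ?G a =
              \<alpha> \<cdot>\<^sub>v vertex_vec ?G a + \<beta> \<cdot>\<^sub>v vertex_vec ?G b"
    using FR by (auto simp: admits_fractional_revival_def fractional_revival_from_to_def
        unitary_cayley_graph_def)
  define E where "E k = exp (- \<i> * of_real t * ramanujan_sum n k)" for k
  define d where "d = int a - int b"
  have H_entry: "transition_matrix ?G t $$ (j, a) =
      (if j = a then \<alpha> else 0) + (if j = b then \<beta> else 0)" if "j < n" for j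
    using transition_matrix_mult_vertex_vec[OF ab(1) that, of t] ab that unfolding H
    by (auto simp: unit_vec_def)
  \<comment> \<open>The Fourier transform of a column supported on \<open>a\<close> and
    \<open>b\<close> has just two terms; dividing by the character at \<open>a\<close> leaves
    \<open>d\<close> as the only trace of the vertices.\<close>
  have E_nat: "E (int k) = \<alpha> + \<beta> * unity_root n (int k * d)" if "k < n" for k
  proof -
    have "E (int k) * unity_root n (- int k * int a) =
        (\<Sum>j<n. unity_root n (- int k * int j) * transition_matrix ?G t $$ (j, a))"
      using sum_unity_root_transition_matrix[OF n that ab(1)] by (simp add: E_def)
    also have "\<dots> = (\<Sum>j<n. (if j = a then \<alpha> * unity_root n (- int k * int j) else 0) +
                        (if j = b then \<beta> * unity_root n (- int k * int j) else 0))"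
      using ab by (intro sum.cong refl) (auto simp: H_entry)
    also have "\<dots> = \<alpha> * unity_root n (- int k * int a) + \<beta> * unity_root n (- int k * int b)"
      using ab by (simp add: sum.distrib)
    also have "unity_root n (- int k * int b) =
        unity_root n (int k * d) * unity_root n (- int k * int a)"
      by (simp add: d_def algebra_simps flip: unity_root_add)
    finally have "E (int k) * unity_root n (- int k * int a) =
        (\<alpha> + \<beta> * unity_root n (int k * d)) * unity_root n (- int k * int a)"
      by (simp add: algebra_simps)
    moreover have "unity_root n (- int k * int a) \<noteq> 0"
      by (simp add: unity_root_def)
    ultimately show ?thesis by simp
  qed
  \<comment> \<open>Periodicity extends the formula to all integers, in particular to
    \<open>k = - 1\<close>.\<close>
  have E: "E k = \<alpha> + \<beta> * unity_root n (k * d)" for k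
  proof -
    define l where "l = nat (k mod int n)"
    have l: "l < n" "[k = int l] (mod int n)"
      using n by (simp_all add: l_def cong_def nat_less_iff)
    have "E k = E (int l)"
      using n l unfolding E_def by (subst ramanujan_sum_cong[of n k "int l"]) auto
    moreover have "unity_root n (k * d) = unity_root n (int l * d)"
      using n l by (simp add: unity_root_eq_iff cong_scalar_right)
    ultimately show ?thesis using E_nat[OF l(1)] by simp
  qed
  have not_dvd: "\<not> int n dvd d"
    using ab by (simp add: d_def flip: mod_eq_dvd_iff)
  \<comment> \<open>Evenness of c_n together with \<open>\<beta> \<noteq> 0\<close> makes
    \<open>unity_root n d\<close> its own inverse.\<close>
  have "E (- 1) = E 1"
    using n by (simp add: E_def)
  then have "unity_root n (- d) = unity_root n d"
    using \<beta> by (simp add: E)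
  then have dvd: "int n dvd 2 * d"
    using n by (simp add: unity_root_eq_iff cong_iff_dvd_diff)
  have "even n"
  proof (rule ccontr)
    assume "odd n"
    then have "coprime (int n) 2" by simp
    with dvd not_dvd show False by (simp add: coprime_dvd_mult_right_iff)
  qed
  moreover have "E k = (if even k then \<alpha> + \<beta> else \<alpha> - \<beta>)" for k
    using E unity_root_half[OF _ dvd not_dvd] n by simp
  moreover have "\<alpha> + \<beta> \<noteq> \<alpha> - \<beta>"
    using \<beta> by simp
  ultimately show ?thesis
    using t unfolding E_def by blast
qed

lemma unitary_cayley_graph_fractional_revivalI:
  assumes n: "n \<ge> 2" "even n" and t: "t > 0" and xy: "x \<noteq> y"
    and E: "\<And>k. exp (- \<i> * of_real t * ramanujan_sum n k) = (if even k then x else y)"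
  shows "admits_fractional_revival (unitary_cayley_graph n)"
proof -
  let ?G = "unitary_cayley_graph n"
  \<comment> \<open>The solution of \<alpha> + \<beta> = x and \<alpha> - \<beta> = y; the revival
    will go from 0 to \<open>m\<close>, the vertex n/2.\<close>
  define \<alpha> \<beta> where "\<alpha> = (x + y) / 2" and "\<beta> = (x - y) / 2"
  obtain m where m: "n = 2 * m" "m > 0" using n by auto
  have half: "unity_root n (k * int m) = (if even k then 1 else - 1)" for k
    using m by (intro unity_root_half) (auto dest: zdvd_imp_le)
  have cmod: "cmod (if even k then x else y) = 1" for k :: int
    using cmod_exp_ramanujan_sum[of n t k] n unfolding E by simp
  have "cmod x = 1" "cmod y = 1"
    using cmod[of 0] cmod[of 1] by simp_all
  then have "(Re x)\<^sup>2 + (Im x)\<^sup>2 = 1" "(Re y)\<^sup>2 + (Im y)\<^sup>2 = 1"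
    by (simp_all flip: cmod_power2)
  \<comment> \<open>Parallelogram law: the left-hand side is half of |x|^2 + |y|^2, and both moduli
    are 1.\<close>
  then have norm: "(cmod \<alpha>)\<^sup>2 + (cmod \<beta>)\<^sup>2 = 1"
    unfolding \<alpha>_def \<beta>_def cmod_power2 by (simp add: power2_eq_square field_simps)
  have E': "exp (- \<i> * of_real t * ramanujan_sum n k) = \<alpha> + \<beta> * unity_root n (k * int m)" for k
    unfolding E half \<alpha>_def \<beta>_def by (simp add: field_simps)
  have entry: "transition_matrix ?G t $$ (j, 0) =
      (if j = 0 then \<alpha> else 0) + (if j = m then \<beta> else 0)" if j: "j < n" for j
  proof -
    have "transition_matrix ?G t $$ (j, 0) =
        (\<Sum>l<n. (\<alpha> + \<beta> * unity_root n (int l * int m)) * unity_root n (int l * int j)) / of_nat n"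
      using n j by (simp add: transition_matrix_entry E' del: mult_minus_left)
    also have "\<dots> = (\<Sum>l<n. \<alpha> * unity_root n (int j * int l) +
                       \<beta> * unity_root n ((int m + int j) * int l)) / of_nat n"
      by (simp add: algebra_simps unity_root_add)
    also have "\<dots> = (\<alpha> * (\<Sum>l<n. unity_root n (int j * int l)) +
                  \<beta> * (\<Sum>l<n. unity_root n ((int m + int j) * int l))) / of_nat n"
      by (simp only: sum.distrib sum_distrib_left)
    also have "\<dots> = (if int n dvd int j then \<alpha> else 0) + (if int n dvd int m + int j then \<beta> else 0)"
      using n by (simp add: sum_unity_root add_divide_distrib)
    also have "int n dvd int j \<longleftrightarrow> j = 0"
      using j by (auto dest: zdvd_imp_le)
    also have "int n dvd int m + int j \<longleftrightarrow> j = m"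
    proof
      assume "int n dvd int m + int j"
      then obtain q where q: "int m + int j = int n * q" by auto
      \<comment> \<open>From 0 < m and m, j < n, the sum m + j lies strictly between 0 and 2n, so
        the multiple can only be \<open>n\<close> itself.\<close>
      have "int n * 0 < int n * q" "int n * q < int n * 2"
        unfolding q[symmetric] using m j by simp_all
      then have "q = 1" by (simp only: mult_less_cancel_left) auto
      with q m show "j = m" by simp
    qed (use m in simp)
    finally show ?thesis .
  qed
  have "transition_matrix ?G t *\<^sub>v vertex_vec ?G 0 =
      \<alpha> \<cdot>\<^sub>v vertex_vec ?G 0 + \<beta> \<cdot>\<^sub>v vertex_vec ?G m"
  proof (rule eq_vecI)
    fix j assume "j < dim_vec (\<alpha> \<cdot>\<^sub>v vertex_vec ?G 0 + \<beta> \<cdot>\<^sub>v vertex_vec ?G m)"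
    then have j: "j < n" by simp
    show "(transition_matrix ?G t *\<^sub>v vertex_vec ?G 0) $ j =
        (\<alpha> \<cdot>\<^sub>v vertex_vec ?G 0 + \<beta> \<cdot>\<^sub>v vertex_vec ?G m) $ j"
      using transition_matrix_mult_vertex_vec[of 0 n j t] entry[OF j] j m
      by (auto simp: unit_vec_def)
  qed (simp add: transition_matrix_def mat_exp_def adjacency_matrix_def)
  moreover have "\<beta> \<noteq> 0" using xy by (simp add: \<beta>_def)
  ultimately have "fractional_revival_from_to ?G 0 m"
    using t norm unfolding fractional_revival_from_to_def by blast
  moreover have "0 \<in> pverts ?G" "m \<in> pverts ?G" "m \<noteq> 0"
    using m by (simp_all add: unitary_cayley_graph_def)
  ultimately show ?thesis
    unfolding admits_fractional_revival_def by blast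
qed

subsection \<open>Evaluation of Ramanujan sums\<close>

lemma sum_lessThan_mult:
  fixes g :: "nat \<Rightarrow> 'a :: comm_monoid_add"
  shows "(\<Sum>u<p * m. g u) = (\<Sum>j<p. \<Sum>u<m. g (u + j * m))"
proof -
  have "sum g {j * m..<j * m + m} = (\<Sum>u<m. g (u + j * m))" for j
    using sum.shift_bounds_nat_ivl[of g 0 "j * m" m] by (simp add: atLeast0LessThan add.commute)
  then show ?thesis
    by (simp flip: sum.nat_group)
qed

text \<open>In the block decomposition \<open>u + j * m\<close>, coprimality to \<open>m\<close>
  depends on \<open>u\<close> alone. The sum over \<open>j\<close> separates and, by orthogonality
  modulo \<open>p\<close>, survives only if \<open>p\<close> divides \<open>k\<close>.\<close>

lemma sum_coprime_unity_root_mult: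
  assumes "p > 0" "m > 0"
  shows "(\<Sum>u<p * m. of_bool (coprime (int u) (int m)) * unity_root (p * m) (k * int u)) =
         (if int p dvd k then of_nat p * ramanujan_sum m (k div int p) else 0)"
proof -
  have split: "unity_root (p * m) (k * int (u + j * m)) =
      unity_root (p * m) (k * int u) * unity_root p (k * int j)" for u j
  proof -
    have "k * int (u + j * m) = k * int u + int m * (k * int j)"
      by (simp add: algebra_simps)
    then show ?thesis
      using unity_root_cancel[of m p "k * int j"] assms by (simp add: unity_root_add mult.commute)
  qed
  have coprime: "coprime (int (u + j * m)) (int m) \<longleftrightarrow> coprime (int u) (int m)" for u j
    using coprime_add_mult_iff[of "int u" "int j" "int m"] by simp
  have "(\<Sum>u<p * m. of_bool (coprime (int u) (int m)) * unity_root (p * m) (k * int u)) =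
      (\<Sum>j<p. \<Sum>u<m. of_bool (coprime (int u) (int m)) * unity_root (p * m) (k * int u) *
         unity_root p (k * int j))"
    by (simp only: sum_lessThan_mult split coprime mult.assoc)
  also have "\<dots> = (\<Sum>u<m. of_bool (coprime (int u) (int m)) * unity_root (p * m) (k * int u)) *
      (\<Sum>j<p. unity_root p (k * int j))"
    by (simp only: sum_distrib_left sum_distrib_right)
  also have "\<dots> = (if int p dvd k then of_nat p * ramanujan_sum m (k div int p) else 0)"
  proof (cases "int p dvd k")
    case True
    then obtain l where l: "k = int p * l" by auto
    then show ?thesis
      using assms sum_unity_root[of p k]
      by (simp add: ramanujan_sum_def mult.assoc unity_root_cancel)
  next
    case False
    then show ?thesis
      using assms by (simp add: sum_unity_root)
  qed
  finally show ?thesis .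
qed

lemma ramanujan_sum_prime_mult:
  assumes p: "prime p" and m: "m > 0"
  shows "ramanujan_sum (p * m) k =
         (if int p dvd k then of_nat p * ramanujan_sum m (k div int p) else 0) -
         (if p dvd m then 0 else ramanujan_sum m k)"
proof (cases "p dvd m")
  case True
  \<comment> \<open>If \<open>p\<close> divides \<open>m\<close>, coprimality to
    \<open>p * m\<close> and to \<open>m\<close> are the same condition, so nothing is
    subtracted.\<close>
  then have "coprime (int u) (int (p * m)) \<longleftrightarrow> coprime (int u) (int m)" for u
    by (metis coprime_divisors coprime_int_iff coprime_mult_right_iff dvd_refl)
  then show ?thesis
    using sum_coprime_unity_root_mult[of p m k] p m True
    by (simp add: ramanujan_sum_def prime_gt_0_nat del: of_nat_mult)
next
  case False
  then have pm: "coprime p m"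
    using p by (simp add: prime_imp_coprime)
  have coprime_iff: "of_bool (coprime (int u) (int (p * m))) =
      (of_bool (coprime (int u) (int m)) - of_bool (coprime (int u) (int m) \<and> p dvd u) :: complex)" for u
    using p by (auto simp: coprime_commute[of _ p] prime_imp_coprime dest: coprime_common_divisor_nat)
  \<comment> \<open>In a block of length \<open>p\<close> only \<open>u = 0\<close> gives a multiple
    of \<open>p\<close>. Coprimality of \<open>j * p\<close> to \<open>m\<close> is then that of
    \<open>j\<close>, and the factor \<open>p\<close> cancels in the root of unity.\<close>
  have inner: "(\<Sum>u<p. of_bool (coprime (int (u + j * p)) (int m) \<and> p dvd u + j * p) *
        unity_root (p * m) (k * int (u + j * p))) =
      of_bool (coprime (int j) (int m)) * unity_root m (k * int j)" for j
  proof -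
    have "(\<Sum>u<p. of_bool (coprime (int (u + j * p)) (int m) \<and> p dvd u + j * p) *
          unity_root (p * m) (k * int (u + j * p))) =
        (\<Sum>u<p. if u = 0 then of_bool (coprime (int (j * p)) (int m)) *
          unity_root (p * m) (k * int (j * p)) else 0)"
      by (intro sum.cong refl) (auto dest: dvd_imp_le)
    also have "\<dots> = of_bool (coprime (int j) (int m)) * unity_root (p * m) (int p * (k * int j))"
      using p pm by (simp add: prime_gt_0_nat mult_ac)
    finally show ?thesis
      using p by (simp add: unity_root_cancel prime_gt_0_nat)
  qed
  have "(\<Sum>u<p * m. of_bool (coprime (int u) (int m) \<and> p dvd u) * unity_root (p * m) (k * int u)) =
      ramanujan_sum m k"
    unfolding mult.commute[of p m] sum_lessThan_mult ramanujan_sum_def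
    using inner by (simp only: mult.commute[of m p])
  then show ?thesis
    using sum_coprime_unity_root_mult[of p m k] p m False
    unfolding ramanujan_sum_def[of "p * m"] coprime_iff left_diff_distrib sum_subtractf
    by (simp only: prime_gt_0_nat if_False)
qed

text \<open>Induction by removing a prime factor \<open>p\<close> of \<open>m\<close>: neither
  \<open>k\<close> nor 1 is divisible by \<open>p\<close>, so the recursion treats both alike, and
  \<open>k\<close> stays coprime to the cofactor.\<close>

lemma ramanujan_sum_coprime:
  assumes "m > 0" "coprime k (int m)"
  shows "ramanujan_sum m k = ramanujan_sum m 1"
  using assms
proof (induction m rule: less_induct)
  case (less m)
  show ?case
  proof (cases "m = 1")
    case True
    then show ?thesis by (simp add: ramanujan_sum_def unity_root_eq_1_iff)
  next
    case False
    then obtain p m' where p: "prime p" and m: "m = p * m'"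
      using prime_factor_nat[of m] by (auto elim!: dvdE)
    have "m' > 0" "m' < m"
      using less.prems m prime_gt_1_nat[OF p] by auto
    moreover have k: "coprime k (int m')" "coprime k (int p)"
      using less.prems m by simp_all
    moreover have "\<not> int p dvd k"
      using k(2) p by (metis coprime_absorb_right not_prime_unit prime_nat_int_transfer)
    ultimately show ?thesis
      using less.IH[of m'] p by (auto simp: m ramanujan_sum_prime_mult)
  qed
qed

lemma squarefree_prime_mult_not_dvd:
  fixes p m :: nat
  assumes "squarefree (p * m)" "prime p"
  shows "\<not> p dvd m"
proof
  assume "p dvd m"
  then have "p\<^sup>2 dvd p * m"
    by (simp add: power2_eq_square)
  with assms show False
    using squarefreeD[of "p * m" p] by simp
qed

text \<open>For m = p m' with \<open>p\<close> not dividing m', the recursion gives (p - 1)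
  c_{m'}(1) at \<open>p\<close> and - c_{m'}(1) at 1.\<close>

lemma ramanujan_sum_prime_of_squarefree:
  assumes "squarefree m" "prime p" "p dvd m"
  shows "ramanujan_sum m (int p) = - (of_nat p - 1) * ramanujan_sum m 1"
proof -
  obtain m' where m: "m = p * m'" using assms by auto
  have "m' > 0" using assms m by (auto intro: Nat.gr0I)
  moreover have "\<not> p dvd m'"
    using assms m squarefree_prime_mult_not_dvd by blast
  moreover from this have "ramanujan_sum m' (int p) = ramanujan_sum m' 1"
    using assms \<open>m' > 0\<close> by (intro ramanujan_sum_coprime) (simp_all add: prime_imp_coprime)
  ultimately show ?thesis
    using assms prime_gt_1_nat[of p] by (simp add: m ramanujan_sum_prime_mult left_diff_distrib)
qed

text \<open>Both terms of the recursion vanish: the first because \<open>p\<close> does not divide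
  \<open>k\<close>, the second because \<open>p\<close> still divides the cofactor.\<close>

lemma ramanujan_sum_eq_0:
  assumes "n > 0" "prime p" "p\<^sup>2 dvd n" "\<not> int p dvd k"
  shows "ramanujan_sum n k = 0"
proof -
  obtain m where m: "n = p * (p * m)"
    using assms by (auto simp: power2_eq_square mult.assoc elim!: dvdE)
  then show ?thesis
    using assms by (subst m, subst ramanujan_sum_prime_mult) auto
qed

section \<open>Necessity: arithmetic constraints on n\<close>

lemma not_squarefree_primeE:
  fixes n :: nat
  assumes "\<not> squarefree n"
  obtains p where "prime p" "p\<^sup>2 dvd n"
proof (cases "n = 0")
  case True
  then show ?thesis using that[of 2] by simp
next
  case False
  then show ?thesis using assms that by (auto simp: squarefree_factorial_semiring)
qed

lemma power_coprime_eq_1: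
  fixes w :: "'a :: comm_monoid_mult"
  assumes "w ^ a = 1" "w ^ b = 1" "coprime a b" "a > 0"
  shows "w = 1"
proof -
  \<comment> \<open>Bezout over the naturals avoids negative exponents, as \<open>w\<close> lies in
    a mere monoid.\<close>
  obtain x y where "a * x = b * y + 1"
    using bezout_nat[of a b] assms by auto
  then have "(w ^ a) ^ x = (w ^ b) ^ y * w"
    by (simp add: mult.commute flip: power_mult)
  with assms show ?thesis by simp
qed

text \<open>The two exponents differ by p z s. Thus equal exponentials at two indices of the same
  parity, with sums \<open>s\<close> and -(p - 1) s, yield a \<open>p\<close>-th root of
  unity.\<close>

lemma exp_mult_power_eq_1:
  fixes z s :: complex
  assumes "exp (z * s) = exp (z * (- (of_nat p - 1) * s))"
  shows "exp (z * s) ^ p = 1"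
proof -
  have "exp (z * s) ^ p = exp (z * s - z * (- (of_nat p - 1) * s))"
    by (simp add: algebra_simps flip: exp_of_nat_mult)
  with assms show ?thesis by (simp add: exp_diff)
qed

lemma two_prime_of_two_valued_exp:
  assumes n: "n > 0" "even n" and xy: "x \<noteq> y"
    and E: "\<And>k. exp (z * ramanujan_sum n k) = (if even k then x else y)"
  shows "n = 2 \<or> (\<exists>p. prime p \<and> n = 2 * p)"
proof (cases "squarefree n")
  case sqf: True
  define s where "s = ramanujan_sum n 1"
  obtain r where r: "n = 2 * r" using n by auto
  have "odd r"
    using sqf r squarefree_prime_mult_not_dvd[of 2 r] by simp
  have E1: "exp (z * s) = y"
    using E[of 1] by (simp add: s_def)
  \<comment> \<open>The prime 2 gives c_n(2) = - c_n(1), so \<open>x\<close> is the inverse of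
    \<open>y\<close>; hence y = 1 would force x = y.\<close>
  have E2: "exp (z * s) * x = 1"
    using E[of 2] ramanujan_sum_prime_of_squarefree[OF sqf, of 2] n
    by (auto simp: s_def simp flip: exp_add)
  \<comment> \<open>Prime divisors of the odd \<open>r\<close> are odd, so the indices
    \<open>p\<close> and 1 share the value \<open>y\<close>.\<close>
  have power: "exp (z * s) ^ p = 1" if "prime p" "p dvd r" for p
  proof (rule exp_mult_power_eq_1)
    have "odd p" using that \<open>odd r\<close> by auto
    then show "exp (z * s) = exp (z * (- (of_nat p - 1) * s))"
      using E[of "int p"] E1 ramanujan_sum_prime_of_squarefree[OF sqf, of p] that r
      by (simp add: s_def)
  qed
  show ?thesis
  proof (cases "r = 1")
    case True
    then show ?thesis using r by simp
  next
    case False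
    then obtain p r' where p: "prime p" and r': "r = p * r'"
      using prime_factor_nat[of r] by (auto elim!: dvdE)
    have "r' = 1"
    proof (rule ccontr)
      assume "r' \<noteq> 1"
      then obtain q where q: "prime q" "q dvd r'"
        using prime_factor_nat[of r'] by auto
      have "p \<noteq> q"
        using sqf q p r r' squarefree_prime_mult_not_dvd[of p "2 * r'"] by (auto simp: mult.left_commute)
      then have "coprime p q" using p q by (simp add: primes_coprime)
      moreover have "exp (z * s) ^ p = 1" "exp (z * s) ^ q = 1"
        using power p q r' by simp_all
      ultimately have "exp (z * s) = 1"
        using prime_gt_0_nat[OF p] power_coprime_eq_1[of "exp (z * s)" p q] by blast
      with E1 E2 xy show False by simp
    qed
    then show ?thesis using p r r' by auto
  qed
next
  case False
  then obtain p where p: "prime p" "p\<^sup>2 dvd n" by (rule not_squarefree_primeE)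
  \<comment> \<open>A square factor makes c_n(1) vanish, which fixes the value on odd
    indices.\<close>
  have y: "y = 1"
    using E[of 1] ramanujan_sum_eq_0[OF n(1) p, of 1] prime_gt_1_nat[OF p(1)] by simp
  obtain m where m: "n = 2 * m" using n by auto
  have m0: "m > 0" using m n by simp
  \<comment> \<open>Otherwise the even value would be 1 as well. This excludes odd \<open>p\<close>,
    and then square factors of \<open>m\<close>.\<close>
  have "ramanujan_sum n 2 \<noteq> 0"
    using E[of 2] y xy by auto
  then have "p dvd 2"
    using ramanujan_sum_eq_0[OF n(1) p, of 2] by (metis int_dvd_int_iff of_nat_numeral)
  then have "p = 2"
    using p by (simp add: primes_dvd_imp_eq)
  then have "even m"
    using p m by (auto simp: power2_eq_square)
  then have double: "ramanujan_sum n (2 * k) = 2 * ramanujan_sum m k" for k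
    using ramanujan_sum_prime_mult[of 2 m "2 * k"] m m0 by simp
  have sqf: "squarefree m"
  proof (rule ccontr)
    assume "\<not> squarefree m"
    then obtain q where q: "prime q" "q\<^sup>2 dvd m" by (rule not_squarefree_primeE)
    have "ramanujan_sum m 1 = 0"
      using ramanujan_sum_eq_0[OF m0 q, of 1] prime_gt_1_nat[OF q(1)] by simp
    with double[of 1] \<open>ramanujan_sum n 2 \<noteq> 0\<close> show False by simp
  qed
  \<comment> \<open>This is c_n(2). The comparison is now between the even indices 2 and 2q, so
    \<open>x\<close> takes over the part of \<open>y\<close>.\<close>
  define s where "s = 2 * ramanujan_sum m 1"
  have E2: "exp (z * s) = x"
    using E[of 2] double[of 1] by (simp add: s_def)
  have power: "exp (z * s) ^ q = 1" if "prime q" "q dvd m" for q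
  proof (rule exp_mult_power_eq_1)
    show "exp (z * s) = exp (z * (- (of_nat q - 1) * s))"
      using E[of "2 * int q"] E2 double[of "int q"] ramanujan_sum_prime_of_squarefree[OF sqf that]
      by (simp add: s_def mult_ac)
  qed
  \<comment> \<open>Besides 2, the squarefree \<open>m\<close> can have no odd prime factor
    \<open>q\<close>: x^2 = x^q = 1 would give x = 1 = y. What remains is n = 4 = 2 * 2.\<close>
  have "m = 2"
  proof (rule ccontr)
    assume "m \<noteq> 2"
    obtain r where r: "m = 2 * r" using \<open>even m\<close> by auto
    with \<open>m \<noteq> 2\<close> obtain q where q: "prime q" "q dvd r"
      using prime_factor_nat[of r] by auto
    have "odd r"
      using sqf r squarefree_prime_mult_not_dvd[of 2 r] by simp
    with q have "coprime 2 q" by auto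
    moreover have "exp (z * s) ^ 2 = 1" "exp (z * s) ^ q = 1"
      using power q r by simp_all
    ultimately have "exp (z * s) = 1"
      using power_coprime_eq_1[of "exp (z * s)" 2 q] by simp
    with E2 y xy show False by simp
  qed
  with m show ?thesis by auto
qed

section \<open>Sufficiency: explicit revival times\<close>

lemma fractional_revival_of_integral_ramanujan_sum:
  assumes n: "n \<ge> 2" "even n" and q: "q > 0"
    and int: "\<And>k. ramanujan_sum n k = of_int (f k)"
    and even: "\<And>k. even k \<Longrightarrow> [f k = u] (mod int q)"
    and odd: "\<And>k. odd k \<Longrightarrow> [f k = v] (mod int q)"
    and uv: "\<not> [u = v] (mod int q)"
  shows "admits_fractional_revival (unitary_cayley_graph n)"
proof (rule unitary_cayley_graph_fractional_revivalI[OF n])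
  \<comment> \<open>At time 2 pi / q the exponential of an integer eigenvalue depends only on its
    residue modulo \<open>q\<close>, so residues constant on each parity class suffice.\<close>
  show "2 * pi / real q > 0"
    using q by simp
  show "unity_root q (- u) \<noteq> unity_root q (- v)"
    using q uv by (simp add: unity_root_eq_iff cong_minus_minus_iff)
  show "exp (- \<i> * of_real (2 * pi / real q) * ramanujan_sum n k) =
      (if even k then unity_root q (- u) else unity_root q (- v))" for k
  proof -
    have "exp (- \<i> * of_real (2 * pi / real q) * ramanujan_sum n k) = unity_root q (- f k)"
      by (simp add: int unity_root_def cis_conv_exp mult.assoc)
    then show ?thesis
      using q even odd by (simp add: unity_root_eq_iff cong_minus_minus_iff)
  qed
qed

lemma ramanujan_sum_1: "ramanujan_sum 1 k = 1"
  by (simp add: ramanujan_sum_def)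

lemma ramanujan_sum_prime:
  assumes "prime p"
  shows "ramanujan_sum p k = (if int p dvd k then of_nat p else 0) - 1"
  using ramanujan_sum_prime_mult[OF assms, of 1 k] assms
  by (simp add: ramanujan_sum_1[unfolded One_nat_def] prime_nat_iff)

text \<open>The eigenvalues are 1 and -1; the modulus 4 separates them, whereas 2 would not.\<close>

lemma fractional_revival_unitary_cayley_graph_2:
  "admits_fractional_revival (unitary_cayley_graph 2)"
  by (rule fractional_revival_of_integral_ramanujan_sum[where q = 4 and u = 1 and v = "- 1" and
        f = "\<lambda>k. if even k then 1 else - 1"])
     (simp_all add: ramanujan_sum_prime cong_def)

lemma fractional_revival_unitary_cayley_graph_2p:
  assumes p: "prime p"
  shows "admits_fractional_revival (unitary_cayley_graph (2 * p))"
proof (cases "p = 2")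
  case True
  \<comment> \<open>Even indices give 2 or -2, which agree modulo 4 and differ from the value 0 at
    odd indices.\<close>
  have "ramanujan_sum (2 * 2) k =
      of_int (if even k then if even (k div 2) then 2 else - 2 else 0)" for k
    using ramanujan_sum_prime_mult[of 2 2 k] by (simp add: ramanujan_sum_prime)
  then have "admits_fractional_revival (unitary_cayley_graph (2 * 2))"
    by (rule fractional_revival_of_integral_ramanujan_sum[where q = 4 and u = 2 and v = 0, rotated -4])
       (simp_all add: cong_def)
  with True show ?thesis by simp
next
  case False
  then have odd: "odd p" using p by (metis primes_dvd_imp_eq two_is_prime_nat)
  \<comment> \<open>The product c_2(k) c_p(k). Modulo \<open>p\<close> its second factor is always
    -1, leaving -1 on even and 1 on odd \<open>k\<close>; these differ because \<open>p\<close> is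
    odd.\<close>
  define f :: "int \<Rightarrow> int" where
    "f k = (if even k then 1 else - 1) * ((if int p dvd k then int p else 0) - 1)" for k
  have dvd_half: "int p dvd k div 2 \<longleftrightarrow> int p dvd k" if "even k" for k
    using that odd by (auto elim!: evenE simp: coprime_dvd_mult_right_iff)
  have "ramanujan_sum (2 * p) k = of_int (f k)" for k
    using ramanujan_sum_prime_mult[of 2 p k] odd p prime_gt_0_nat[OF p]
    by (simp add: ramanujan_sum_prime f_def dvd_half)
  moreover have "\<not> [- 1 = 1 :: int] (mod int p)"
  proof
    assume "[- 1 = 1 :: int] (mod int p)"
    then have "int p dvd 2"
      by (simp add: cong_iff_dvd_diff)
    then have "p dvd 2"
      by (metis int_dvd_int_iff of_nat_numeral)
    with False p show False by (simp add: primes_dvd_imp_eq)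
  qed
  ultimately show ?thesis
    using prime_ge_2_nat[OF p]
    by (intro fractional_revival_of_integral_ramanujan_sum[where q = p and f = f and u = "- 1" and v = 1])
       (auto simp: f_def cong_iff_dvd_diff)
qed

theorem mainTheorem2:
  fixes n :: nat
  assumes "n > 0"
  shows "admits_fractional_revival (unitary_cayley_graph n) \<longleftrightarrow>
           n = 2 \<or> (\<exists>p::nat. prime p \<and> n = 2 * p)"
proof
  assume FR: "admits_fractional_revival (unitary_cayley_graph n)"
  \<comment> \<open>With a single vertex there is no target distinct from the source.\<close>
  then have "n \<ge> 2"
    using assms by (auto simp: admits_fractional_revival_def unitary_cayley_graph_def)
  from unitary_cayley_graph_fractional_revivalD[OF this FR]
  obtain t x y where "even n" "x \<noteq> y"
    "\<And>k. exp (- \<i> * of_real t * ramanujan_sum n k) = (if even k then x else y)"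
    by blast
  then show "n = 2 \<or> (\<exists>p. prime p \<and> n = 2 * p)"
    using assms by (intro two_prime_of_two_valued_exp)
next
  assume "n = 2 \<or> (\<exists>p. prime p \<and> n = 2 * p)"
  then show "admits_fractional_revival (unitary_cayley_graph n)"
    using fractional_revival_unitary_cayley_graph_2 fractional_revival_unitary_cayley_graph_2p by auto
qed

end
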